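(* Sinkhorn's algorithm, when applied to matrix balancing formulations of various choice modeling problems, is equivalent to the following algorithms: (1) the iterative algorithms of Zermelo (1929), Dykstra (1956) and Ford (1957) for the Bradley–Terry–Luce (BTL) model of pairwise comparison data; (2) the MM algorithm of Hunter (2004) for the Plackett–Luce model of ranking data; (3) the unregularized version of the ChoiceRank algorithm of Maystre and Grossglauser (2017) for their network choice model; (4) the Berry–Levinsohn–Pakes (BLP, 1995) algorithm in a logit random utility model with only intercepts. Moreover, Sinkhorn's algorithm can be viewed as a general MM algorithm as well as a message passing algorithm, and in the latter case it is a variant of the accelerated spectral ranking (ASR) algorithm of Agarwal, Patil and Agarwal (2018) for Luce choice models, based on a different moment condition.
   Context: "Equivalent" is meant in the algebraic sense: the update of Sinkhorn's algorithm on the matrix balancing formulation of the problem reduces algebraically to the update of the named algorithm. Sinkhorn's algorithm. Given $A\in\mathbb{R}_+^{n\times m}$, $p\in\mathbb{R}^n_{++}$, $q\in\mathbb{R}^m_{++}$ with $\sum_ip_i=\sum_jq_j$, it seeks positive diagonal $D^1,D^0$ such that $D^1AD^0$ has row sums $p$ and column sums $q$. Starting from $d^0\in\mathbb{R}^m_{++}$ it repeats $d^1\leftarrow p/(Ad^0)$, $d^0\leftarrow q/(A^Td^1)$ (entrywise divisions), where $d^0,d^1$ are the diagonals of $D^0,D^1$. Matrix balancing formulation of Luce choice estimation. In the Luce model, item $j\in[m]$ has score $s_j>0$ and is chosen from a choice set $S\ni j$ with probability $s_j/\sum_{k\in S}s_k$. In a dataset, let $S_1,\dots,S_n$ be the distinct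 choice sets, $R_i$ the number of observations with choice set $S_i$, $W_{ji}$ the number of those in which $j$ is chosen, and $W_j=\sum_iW_{ji}$. Put $p_i=R_i$, $q_j=W_j$, $A_{ij}=1$ if $j\in S_i$ and $0$ otherwise, and identify $d^0=s$. One full Sinkhorn iteration is then $s_j^{(t+1)}=W_j\big/\sum_{i:\,j\in S_i}\frac{R_i}{\sum_{k\in S_i}s_k^{(t)}}$. It is based on the maximum likelihood optimality (moment) condition $W_j=\sum_{i:\,j\in S_i}R_i\frac{s_j}{\sum_{k\in S_i}s_k}$. The named algorithms. (1) With $W_j$ the number of wins of $j$ and $C_{jk}$ the number of comparisons between $j$ and $k$: $s_j^{(t+1)}=W_j\big/\sum_{k\neq j}\frac{C_{jk}}{s_j^{(t)}+s_k^{(t)}}$ (Ford's algorithm is a cyclic version of this update). (2) For partial rankings $a(i,1)\to\cdots\to a(i,l_i)$ (best first), $i=1,\dots,N$, each broken into $l_i-1$ choices of $a(i,j)$ from $\{a(i,j),\dots,a(i,l_i)\}$: $s_k^{(t+1)}=w_k\big/\sum_{i=1}^N\sum_{j=1}^{l_i-1}\delta_{ijk}\big[\sum_{j'=j}^{l_i}s^{(t)}_{a(i,j')}\big]^{-1}$, where $\delta_{ijk}$ is the indicator that item $k$ appears in ranking $i$ and ranks no better than the $j$-th ranked item, and $w_k$ is the number of rankings in which $k$ appears but is not ranked last. (3) On a directed graph with $N_j^{\mathrm{out}},N_j^{\mathrm{in}}$ the out- and in-neighbours of node $j$, a user at $j$ moves to $k\in N_j^{\mathrm{out}}$ with probability proportional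 to $s_k$; $c_{jk}$ is the number of observed transitions along $(j,k)$, $c_j^{\mathrm{in}}=\sum_{k\in N_j^{\mathrm{in}}}c_{kj}$, $c_j^{\mathrm{out}}=\sum_{k\in N_j^{\mathrm{out}}}c_{jk}$. The update is $s_j^{(t+1)}=c_j^{\mathrm{in}}\big/\sum_{k\in N_j^{\mathrm{in}}}\gamma_k^{(t)}$ with $\gamma_j^{(t)}=c_j^{\mathrm{out}}\big/\sum_{k\in N_j^{\mathrm{out}}}s_k^{(t)}$. (4) With utility intercepts $\theta_j=\log s_j$, all alternatives available in every observation, expected market shares $p_j(\theta)=e^{\theta_j}/\sum_ke^{\theta_k}$ and observed market shares $\hat p_j$: $\theta_j^{(t+1)}=\theta_j^{(t)}+\log\hat p_j-\log p_j(\theta^{(t)})$. An MM (minorization–maximization or majorization–minimization) algorithm for maximizing a function alternates between constructing a lower bound (minorizing function) that touches the function at the current iterate and maximizing that lower bound (symmetrically for minimization). Message passing and ASR. On the bipartite graph with item nodes $j$, choice set nodes $i$, and an edge when $j\in S_i$, a message passing algorithm has item nodes send their current estimates to neighbouring choice set nodes, which aggregate them and send back messages that the item nodes use to update their estimates. ASR is $s_j^{(t+1)}=\frac{1}{\sum_{i:\,j\in S_i}R_i}\sum_{i:\,j\in S_i}W_{ji}\sum_{k\in S_i}s_k^{(t)}$, based on the moment condition $\sum_{i:\,j\in S_i}R_i=\sum_{i:\,j\in S_i}W_{ji}\big/\frac{s_j}{\sum_{k\in S_i}s_k}$. *)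

theory Defs
  imports Complex_Main "HOL-Library.Multiset" "HOL-Library.FuncSet" "HOL-Library.Numeral_Type"
begin

section \<open>Matrix balancing and Sinkhorn's algorithm\<close>

text \<open>
  The columns are indexed by a finite type, the rows by a finite set \<^term>\<open>I\<close>: in the applications
  the columns are the items, which are fixed, and the rows are the distinct choice sets, which depend
  on the data.
\<close>

definition balancing_problem ::
  "'r set \<Rightarrow> ('r \<Rightarrow> 'a::finite \<Rightarrow> real) \<Rightarrow> ('r \<Rightarrow> real) \<Rightarrow> ('a \<Rightarrow> real) \<Rightarrow> bool" where
  "balancing_problem I A p q \<longleftrightarrow>
     finite I \<and> (\<forall>i\<in>I. \<forall>j. 0 \<le> A i j) \<and> (\<forall>i\<in>I. 0 < p i) \<and> (\<forall>j. 0 < q j) \<and>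
     (\<Sum>i\<in>I. p i) = (\<Sum>j\<in>UNIV. q j)"

text \<open>No zero row and no zero column: exactly what makes the divisions in the algorithm meaningful.\<close>

definition no_zero_lines :: "'r set \<Rightarrow> ('r \<Rightarrow> 'a::finite \<Rightarrow> real) \<Rightarrow> bool" where
  "no_zero_lines I A \<longleftrightarrow> (\<forall>i\<in>I. \<exists>j. A i j \<noteq> 0) \<and> (\<forall>j. \<exists>i\<in>I. A i j \<noteq> 0)"

definition sinkhorn_d1 ::
  "('r \<Rightarrow> 'a::finite \<Rightarrow> real) \<Rightarrow> ('r \<Rightarrow> real) \<Rightarrow> ('a \<Rightarrow> real) \<Rightarrow> 'r \<Rightarrow> real" where
  "sinkhorn_d1 A p d0 i = p i / (\<Sum>j\<in>UNIV. A i j * d0 j)"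

definition sinkhorn_d0 ::
  "'r set \<Rightarrow> ('r \<Rightarrow> 'a::finite \<Rightarrow> real) \<Rightarrow> ('a \<Rightarrow> real) \<Rightarrow> ('r \<Rightarrow> real) \<Rightarrow> 'a \<Rightarrow> real" where
  "sinkhorn_d0 I A q d1 j = q j / (\<Sum>i\<in>I. A i j * d1 i)"

definition sinkhorn_step ::
  "'r set \<Rightarrow> ('r \<Rightarrow> 'a::finite \<Rightarrow> real) \<Rightarrow> ('r \<Rightarrow> real) \<Rightarrow> ('a \<Rightarrow> real) \<Rightarrow> ('a \<Rightarrow> real) \<Rightarrow> 'a \<Rightarrow> real" where
  "sinkhorn_step I A p q d0 = sinkhorn_d0 I A q (sinkhorn_d1 A p d0)"

section \<open>Luce choice data\<close>

text \<open>A data set is the multiset of its observations (choice set, chosen item).\<close>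

type_synonym 'a choice_data = "('a set \<times> 'a) multiset"

definition luce_data :: "'a choice_data \<Rightarrow> bool" where
  "luce_data D \<longleftrightarrow> (\<forall>(S, j) \<in> set_mset D. j \<in> S)"

definition choice_sets :: "'a choice_data \<Rightarrow> 'a set set" where
  "choice_sets D = fst ` set_mset D"

definition n_obs :: "'a choice_data \<Rightarrow> 'a set \<Rightarrow> nat" where  \<comment> \<open>\<open>R\<^sub>i\<close>\<close>
  "n_obs D S = size (filter_mset (\<lambda>x. fst x = S) D)"

definition n_chosen :: "'a choice_data \<Rightarrow> 'a \<Rightarrow> 'a set \<Rightarrow> nat" where  \<comment> \<open>\<open>W\<^sub>j\<^sub>i\<close>\<close>
  "n_chosen D j S = count D (S, j)"

definition n_wins :: "'a choice_data \<Rightarrow> 'a \<Rightarrow> nat" where  \<comment> \<open>\<open>W\<^sub>j\<close>\<close>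
  "n_wins D j = (\<Sum>S\<in>choice_sets D. n_chosen D j S)"

definition incidence :: "'a set \<Rightarrow> 'a \<Rightarrow> real" where
  "incidence S j = (if j \<in> S then 1 else 0)"

definition luce_balancing_problem :: "'a::finite choice_data \<Rightarrow> bool" where
  "luce_balancing_problem D \<longleftrightarrow>
     balancing_problem (choice_sets D) incidence (\<lambda>S. real (n_obs D S)) (\<lambda>j. real (n_wins D j))"

definition luce_sinkhorn :: "'a::finite choice_data \<Rightarrow> ('a \<Rightarrow> real) \<Rightarrow> 'a \<Rightarrow> real" where
  "luce_sinkhorn D =
     sinkhorn_step (choice_sets D) incidence (\<lambda>S. real (n_obs D S)) (\<lambda>j. real (n_wins D j))"

definition luce_loglik :: "'a choice_data \<Rightarrow> ('a \<Rightarrow> real) \<Rightarrow> real" where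
  "luce_loglik D s = (\<Sum>(S, j)\<in>#D. ln (s j / (\<Sum>k\<in>S. s k)))"

definition ml_moment :: "'a choice_data \<Rightarrow> ('a \<Rightarrow> real) \<Rightarrow> bool" where
  "ml_moment D s \<longleftrightarrow>
     (\<forall>j. real (n_wins D j) =
        (\<Sum>S\<in>{S \<in> choice_sets D. j \<in> S}. real (n_obs D S) * (s j / (\<Sum>k\<in>S. s k))))"

section \<open>Comparing iterations\<close>

definition positive :: "('a \<Rightarrow> real) \<Rightarrow> bool" where
  "positive s \<longleftrightarrow> (\<forall>j. 0 < s j)"

text \<open>Equal updates at every positive vector, and equal iterates from every positive start.\<close>

definition same_iteration ::
  "(('a \<Rightarrow> real) \<Rightarrow> 'a \<Rightarrow> real) \<Rightarrow> (('a \<Rightarrow> real) \<Rightarrow> 'a \<Rightarrow> real) \<Rightarrow> bool" where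
  "same_iteration T U \<longleftrightarrow>
     (\<forall>s. positive s \<longrightarrow> T s = U s) \<and> (\<forall>s t. positive s \<longrightarrow> (T ^^ t) s = (U ^^ t) s)"

text \<open>
  One sweep of the cyclic version of an update: the components are updated one after the other in the
  order \<^term>\<open>js\<close>, each from the current values of all the others.
\<close>

definition cyclic :: "(('a \<Rightarrow> real) \<Rightarrow> 'a \<Rightarrow> real) \<Rightarrow> 'a list \<Rightarrow> ('a \<Rightarrow> real) \<Rightarrow> 'a \<Rightarrow> real" where
  "cyclic T js s = fold (\<lambda>j x. x(j := T x j)) js s"

section \<open>Pairwise comparisons\<close>

text \<open>The data is the multiset of pairs (winner, loser).\<close>

definition btl_data :: "('a \<times> 'a) multiset \<Rightarrow> bool" where
  "btl_data C \<longleftrightarrow> (\<forall>(j, k) \<in> set_mset C. j \<noteq> k)"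

definition btl_wins :: "('a \<times> 'a) multiset \<Rightarrow> 'a \<Rightarrow> nat" where
  "btl_wins C j = size (filter_mset (\<lambda>c. fst c = j) C)"

definition btl_comparisons :: "('a \<times> 'a) multiset \<Rightarrow> 'a \<Rightarrow> 'a \<Rightarrow> nat" where
  "btl_comparisons C j k = size (filter_mset (\<lambda>c. c = (j, k) \<or> c = (k, j)) C)"

definition zermelo_step :: "('a::finite \<times> 'a) multiset \<Rightarrow> ('a \<Rightarrow> real) \<Rightarrow> 'a \<Rightarrow> real" where
  "zermelo_step C s j =
     real (btl_wins C j) / (\<Sum>k\<in>UNIV - {j}. real (btl_comparisons C j k) / (s j + s k))"

definition btl_choices :: "('a \<times> 'a) multiset \<Rightarrow> 'a choice_data" where
  "btl_choices C = image_mset (\<lambda>(j, k). ({j, k}, j)) C"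

section \<open>Rankings\<close>

text \<open>
  The ranking \<^term>\<open>i\<close>, for \<^term>\<open>i \<in> {1..N::nat}\<close>, is \<open>a i 1 \<rightarrow> \<dots> \<rightarrow> a i (l i)\<close>, best item first.
\<close>

definition rankings :: "nat \<Rightarrow> (nat \<Rightarrow> nat) \<Rightarrow> (nat \<Rightarrow> nat \<Rightarrow> 'a) \<Rightarrow> bool" where
  "rankings N l a \<longleftrightarrow> (\<forall>i\<in>{1..N}. 1 \<le> l i \<and> inj_on (a i) {1..l i})"

definition pl_wins :: "nat \<Rightarrow> (nat \<Rightarrow> nat) \<Rightarrow> (nat \<Rightarrow> nat \<Rightarrow> 'a) \<Rightarrow> 'a \<Rightarrow> nat" where
  "pl_wins N l a k = card {i \<in> {1..N}. k \<in> a i ` {1..l i} \<and> k \<noteq> a i (l i)}"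

definition pl_delta :: "(nat \<Rightarrow> nat) \<Rightarrow> (nat \<Rightarrow> nat \<Rightarrow> 'a) \<Rightarrow> nat \<Rightarrow> nat \<Rightarrow> 'a \<Rightarrow> real" where
  "pl_delta l a i j k = (if \<exists>r\<in>{1..l i}. a i r = k \<and> j \<le> r then 1 else 0)"

definition hunter_step ::
  "nat \<Rightarrow> (nat \<Rightarrow> nat) \<Rightarrow> (nat \<Rightarrow> nat \<Rightarrow> 'a) \<Rightarrow> ('a \<Rightarrow> real) \<Rightarrow> 'a \<Rightarrow> real" where
  "hunter_step N l a s k =
     real (pl_wins N l a k) /
     (\<Sum>i=1..N. \<Sum>j=1..l i - 1. pl_delta l a i j k * inverse (\<Sum>j'=j..l i. s (a i j')))"

definition pl_choices :: "nat \<Rightarrow> (nat \<Rightarrow> nat) \<Rightarrow> (nat \<Rightarrow> nat \<Rightarrow> 'a) \<Rightarrow> 'a choice_data" where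
  "pl_choices N l a = (\<Sum>i=1..N. \<Sum>j=1..l i - 1. {# (a i ` {j..l i}, a i j) #})"

section \<open>Network choice\<close>

text \<open>A directed graph is its edge set \<^term>\<open>E\<close>; the data is the multiset of observed transitions.\<close>

definition n_out :: "('a \<times> 'a) set \<Rightarrow> 'a \<Rightarrow> 'a set" where
  "n_out E j = {k. (j, k) \<in> E}"

definition n_in :: "('a \<times> 'a) set \<Rightarrow> 'a \<Rightarrow> 'a set" where
  "n_in E j = {k. (k, j) \<in> E}"

definition c_out :: "('a \<times> 'a) set \<Rightarrow> ('a \<times> 'a) multiset \<Rightarrow> 'a \<Rightarrow> nat" where
  "c_out E T j = (\<Sum>k\<in>n_out E j. count T (j, k))"

definition c_in :: "('a \<times> 'a) set \<Rightarrow> ('a \<times> 'a) multiset \<Rightarrow> 'a \<Rightarrow> nat" where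
  "c_in E T j = (\<Sum>k\<in>n_in E j. count T (k, j))"

definition choicerank_gamma ::
  "('a \<times> 'a) set \<Rightarrow> ('a \<times> 'a) multiset \<Rightarrow> ('a \<Rightarrow> real) \<Rightarrow> 'a \<Rightarrow> real" where
  "choicerank_gamma E T s j = real (c_out E T j) / (\<Sum>k\<in>n_out E j. s k)"

definition choicerank_step ::
  "('a \<times> 'a) set \<Rightarrow> ('a \<times> 'a) multiset \<Rightarrow> ('a \<Rightarrow> real) \<Rightarrow> 'a \<Rightarrow> real" where
  "choicerank_step E T s j = real (c_in E T j) / (\<Sum>k\<in>n_in E j. choicerank_gamma E T s k)"

text \<open>
  Nodes with the same out-neighbours yield the same choice set; such nodes share one row of the matrix
  balancing problem although ChoiceRank treats them separately.
\<close>

definition network_choices :: "('a \<times> 'a) set \<Rightarrow> ('a \<times> 'a) multiset \<Rightarrow> 'a choice_data" where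
  "network_choices E T = image_mset (\<lambda>(j, k). (n_out E j, k)) T"

section \<open>Logit demand with intercepts only\<close>

text \<open>The data is the multiset of chosen alternatives.\<close>

definition expected_share :: "('a::finite \<Rightarrow> real) \<Rightarrow> 'a \<Rightarrow> real" where
  "expected_share \<theta> j = exp (\<theta> j) / (\<Sum>k\<in>UNIV. exp (\<theta> k))"

definition observed_share :: "'a multiset \<Rightarrow> 'a \<Rightarrow> real" where
  "observed_share M j = real (count M j) / real (size M)"

definition blp_step :: "'a::finite multiset \<Rightarrow> ('a \<Rightarrow> real) \<Rightarrow> 'a \<Rightarrow> real" where
  "blp_step M \<theta> j = \<theta> j + ln (observed_share M j) - ln (expected_share \<theta> j)"

definition logit_choices :: "'a multiset \<Rightarrow> 'a choice_data" where
  "logit_choices M = image_mset (\<lambda>j. (UNIV, j)) M"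

section \<open>MM algorithms\<close>

text \<open>
  \<^term>\<open>T\<close> is the MM algorithm that maximizes \<^term>\<open>f\<close> over \<^term>\<open>X\<close> by means of the
  surrogates \<^term>\<open>Q y\<close>: a lower bound of \<^term>\<open>f\<close> that touches it at \<^term>\<open>y\<close>, and whose
  unique maximizer is the next iterate.
\<close>

definition MM_algorithm ::
  "'v set \<Rightarrow> ('v \<Rightarrow> real) \<Rightarrow> ('v \<Rightarrow> 'v \<Rightarrow> real) \<Rightarrow> ('v \<Rightarrow> 'v) \<Rightarrow> bool" where
  "MM_algorithm X f Q T \<longleftrightarrow>
     (\<forall>y\<in>X. (\<forall>x\<in>X. Q y x \<le> f x) \<and> Q y y = f y \<and>
            T y \<in> X \<and> (\<forall>x\<in>X. x \<noteq> T y \<longrightarrow> Q y x < Q y (T y)))"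

text \<open>
  Up to a constant, the dual objective of the matrix balancing problem maximized over \<open>d1\<close>. For
  the Luce instance it is the log-likelihood.
\<close>

definition sinkhorn_potential ::
  "'r set \<Rightarrow> ('r \<Rightarrow> 'a::finite \<Rightarrow> real) \<Rightarrow> ('r \<Rightarrow> real) \<Rightarrow> ('a \<Rightarrow> real) \<Rightarrow> ('a \<Rightarrow> real) \<Rightarrow> real" where
  "sinkhorn_potential I A p q s =
     (\<Sum>j\<in>UNIV. q j * ln (s j)) - (\<Sum>i\<in>I. p i * ln (\<Sum>j\<in>UNIV. A i j * s j))"

text \<open>
  From \<open>ln u \<le> ln v + u / v - 1\<close> with \<open>u\<close> and \<open>v\<close> the row sums at \<^term>\<open>x\<close> and \<^term>\<open>y\<close>. The factors
  \<open>p i / v\<close> are Sinkhorn's row scaling: updating \<open>d1\<close> constructs the lower bound.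
\<close>

definition sinkhorn_minorizer ::
  "'r set \<Rightarrow> ('r \<Rightarrow> 'a::finite \<Rightarrow> real) \<Rightarrow> ('r \<Rightarrow> real) \<Rightarrow> ('a \<Rightarrow> real) \<Rightarrow>
   ('a \<Rightarrow> real) \<Rightarrow> ('a \<Rightarrow> real) \<Rightarrow> real" where
  "sinkhorn_minorizer I A p q y x =
     (\<Sum>j\<in>UNIV. q j * ln (x j)) -
     (\<Sum>i\<in>I. sinkhorn_d1 A p y i * (\<Sum>j\<in>UNIV. A i j * x j)
               + p i * (ln (\<Sum>j\<in>UNIV. A i j * y j) - 1))"

section \<open>Message passing and accelerated spectral ranking\<close>

text \<open>
  The graph has an edge between the item \<^term>\<open>j\<close> and the choice set \<^term>\<open>S \<in> I\<close> iff
  \<^term>\<open>j \<in> S\<close>. Each choice set node computes \<^term>\<open>agg S\<close> from the estimates of its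
  neighbours and answers the item \<^term>\<open>j\<close> with \<^term>\<open>reply S j\<close> of the result; each item node
  computes \<^term>\<open>upd j\<close> from the answers of its neighbours. The restrictions make sure that a
  node sees only what its neighbours have sent.
\<close>

definition message_passing_step ::
  "'a set set \<Rightarrow> ('a set \<Rightarrow> ('a \<Rightarrow> real) \<Rightarrow> real) \<Rightarrow> ('a set \<Rightarrow> 'a \<Rightarrow> real \<Rightarrow> real) \<Rightarrow>
   ('a \<Rightarrow> ('a set \<Rightarrow> real) \<Rightarrow> real) \<Rightarrow> ('a \<Rightarrow> real) \<Rightarrow> 'a \<Rightarrow> real" where
  "message_passing_step I agg reply upd s j =
     upd j (restrict (\<lambda>S. reply S j (agg S (restrict s S))) {S \<in> I. j \<in> S})"

definition asr_step :: "'a choice_data \<Rightarrow> ('a \<Rightarrow> real) \<Rightarrow> 'a \<Rightarrow> real" where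
  "asr_step D s j =
     1 / (\<Sum>S\<in>{S \<in> choice_sets D. j \<in> S}. real (n_obs D S)) *
     (\<Sum>S\<in>{S \<in> choice_sets D. j \<in> S}. real (n_chosen D j S) * (\<Sum>k\<in>S. s k))"

definition asr_moment :: "'a choice_data \<Rightarrow> ('a \<Rightarrow> real) \<Rightarrow> bool" where
  "asr_moment D s \<longleftrightarrow>
     (\<forall>j. (\<Sum>S\<in>{S \<in> choice_sets D. j \<in> S}. real (n_obs D S)) =
        (\<Sum>S\<in>{S \<in> choice_sets D. j \<in> S}. real (n_chosen D j S) / (s j / (\<Sum>k\<in>S. s k))))"

end

theory Submission
  imports Defs "HOL-Analysis.Cartesian_Space"
begin

text \<open>
  Grouping equal choice sets does not change a sum over the observations, so the denominators of
  Sinkhorn's update for Luce data are sums over the single observations. Each of the named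
  algorithms has the same numerators and denominators, up to regrouping its own data. For the
  minorization, \<open>ln u \<le> ln v + u / v - 1\<close> gives the lower bound, which separates over the
  coordinates into terms \<open>q\<^sub>j ln x\<^sub>j - c\<^sub>j x\<^sub>j\<close> with unique maximizer \<open>q\<^sub>j / c\<^sub>j\<close>.
\<close>

section \<open>Multiset sums\<close>

text \<open>The regrouping principle behind the comparisons below: equal elements of
  \<open>M\<close> are collected with their multiplicity. \<open>K\<close> may exceed the support
  because elements outside it have multiplicity 0.\<close>

lemma sum_count_mult:
  fixes g :: "'b \<Rightarrow> 'c::comm_semiring_1"
  assumes "finite K" "set_mset M \<subseteq> K"
  shows "(\<Sum>y\<in>K. of_nat (count M y) * g y) = (\<Sum>y\<in>#M. g y)"
  using assms(2)
proof (induction M)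
  case empty
  then show ?case by simp
next
  case (add x M)
  have "(\<Sum>y\<in>K. of_nat (count (add_mset x M) y) * g y) =
      (\<Sum>y\<in>K. (if y = x then g y else 0) + of_nat (count M y) * g y)"
    by (rule sum.cong) (auto simp: algebra_simps)
  with add assms(1) show ?case by (simp add: sum.distrib)
qed

lemma size_filter_eq_count: "size (filter_mset (\<lambda>x. f x = y) M) = count (image_mset f M) y"
  by (induction M) auto

text \<open>A marginal of the joint multiplicities. It yields the wins of an item as well as the in-
  and out-counts of a node.\<close>

lemma sum_count_Pair_left:
  assumes "finite K" "fst ` set_mset M \<subseteq> K"
  shows "(\<Sum>x\<in>K. count M (x, y)) = count (image_mset snd M) y"
  using assms(2)
proof (induction M)
  case (add z M)
  obtain a b where z: "z = (a, b)" by (cases z)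
  have "(\<Sum>x\<in>K. count (add_mset z M) (x, y)) =
      (\<Sum>x\<in>K. (if x = a then if b = y then 1 else 0 else 0) + count M (x, y))"
    by (rule sum.cong) (auto simp: z)
  with add assms(1) show ?case by (simp add: sum.distrib z)
qed simp

section \<open>Sinkhorn's algorithm for Luce data\<close>

lemma finite_choice_sets [simp]: "finite (choice_sets D)"
  by (simp add: choice_sets_def)

lemma n_obs_eq_count: "n_obs D S = count (image_mset fst D) S"
  by (simp add: n_obs_def size_filter_eq_count)

lemma n_wins_eq_count: "n_wins D j = count (image_mset snd D) j"
  unfolding n_wins_def n_chosen_def by (rule sum_count_Pair_left) (auto simp: choice_sets_def)

lemma sum_n_obs_mult:
  "(\<Sum>S\<in>choice_sets D. real (n_obs D S) * g S) = (\<Sum>x\<in>#D. g (fst x))"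
  using sum_count_mult[of "choice_sets D" "image_mset fst D" g]
  by (simp add: n_obs_eq_count choice_sets_def image_mset.compositionality comp_def)

lemma n_obs_pos: "S \<in> choice_sets D \<Longrightarrow> 0 < n_obs D S"
  by (auto simp: n_obs_eq_count choice_sets_def)

lemma sum_incidence: "(\<Sum>k\<in>UNIV. incidence S k * s k) = (\<Sum>k\<in>S. s (k :: 'a::finite))"
  by (simp add: incidence_def if_distrib[of "\<lambda>c. c * _"] sum.If_cases)

lemma sum_incidence_rows:
  "finite I \<Longrightarrow> (\<Sum>S\<in>I. incidence S j * g S) = (\<Sum>S\<in>{S \<in> I. j \<in> S}. g S)"
  by (auto simp: sum.inter_filter incidence_def intro!: sum.cong)

lemma luce_sinkhorn_sets:
  "luce_sinkhorn D s j =
     real (n_wins D j) / (\<Sum>S\<in>{S \<in> choice_sets D. j \<in> S}. real (n_obs D S) / (\<Sum>k\<in>S. s k))"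
  unfolding luce_sinkhorn_def sinkhorn_step_def sinkhorn_d0_def sinkhorn_d1_def
    sum_incidence sum_incidence_rows[OF finite_choice_sets] ..

text \<open>The named algorithms group their data in different ways. Here each observation
  contributes its own term to the denominator, so the merging of equal choice sets need not be
  tracked when the updates are compared.\<close>

lemma luce_sinkhorn_obs:
  "luce_sinkhorn D s j =
     real (n_wins D j) / (\<Sum>x\<in>#D. incidence (fst x) j / (\<Sum>k\<in>fst x. s k))"
proof -
  have "(\<Sum>S\<in>choice_sets D. incidence S j * (real (n_obs D S) / (\<Sum>k\<in>S. s k))) =
      (\<Sum>S\<in>choice_sets D. real (n_obs D S) * (incidence S j / (\<Sum>k\<in>S. s k)))"
    by (simp add: mult.commute)
  then show ?thesis
    unfolding luce_sinkhorn_sets sum_incidence_rows[OF finite_choice_sets, symmetric] sum_n_obs_mult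
    by (rule arg_cong)
qed

text \<open>A win of \<open>j\<close> is an observation whose choice set contains \<open>j\<close>.
  This excludes zero columns of the incidence matrix and zero denominators in the updates.\<close>

lemma obtain_win:
  assumes "luce_data D" "0 < n_wins D j"
  obtains S where "S \<in> choice_sets D" "j \<in> S"
proof -
  from assms(2) have "j \<in># image_mset snd D"
    by (simp add: n_wins_eq_count)
  then obtain S where S: "(S, j) \<in># D"
    by auto
  from S have "S \<in> choice_sets D"
    by (force simp: choice_sets_def)
  moreover from S assms(1) have "j \<in> S"
    by (auto simp: luce_data_def)
  ultimately show ?thesis
    by (rule that)
qed

lemma choice_set_nonempty:
  "luce_data D \<Longrightarrow> S \<in> choice_sets D \<Longrightarrow> S \<noteq> {}"
  by (force simp: luce_data_def choice_sets_def)

lemma choice_set_sum_pos: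
  fixes D :: "'a::finite choice_data"
  assumes "luce_data D" "positive s" "S \<in> choice_sets D"
  shows "0 < (\<Sum>k\<in>S. s k)"
  using assms choice_set_nonempty[of D S] by (intro sum_pos) (auto simp: positive_def)

text \<open>Each observation has exactly one choice set and one chosen item, so the row and the
  column targets both total \<open>size D\<close>.\<close>

lemma luce_balancing_problemI:
  assumes "\<And>j. 0 < n_wins D (j :: 'a::finite)"
  shows "luce_balancing_problem D"
proof -
  have "(\<Sum>S\<in>choice_sets D. real (n_obs D S)) = real (size D)"
    using sum_n_obs_mult[of D "\<lambda>_. 1"] by simp
  moreover have "(\<Sum>j\<in>UNIV. real (n_wins D j)) = real (size D)"
    using sum_count_mult[of UNIV "image_mset snd D" "\<lambda>_. 1 :: real"] by (simp add: n_wins_eq_count)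
  ultimately show ?thesis
    using assms by (auto simp: luce_balancing_problem_def balancing_problem_def n_obs_pos incidence_def)
qed

lemma luce_no_zero_lines:
  fixes D :: "'a::finite choice_data"
  assumes "luce_data D" "\<And>j. 0 < n_wins D j"
  shows "no_zero_lines (choice_sets D) incidence"
proof -
  have "\<exists>S\<in>choice_sets D. incidence S j \<noteq> 0" for j
  proof -
    obtain S where "S \<in> choice_sets D" "j \<in> S"
      using assms(1) assms(2)[of j] by (rule obtain_win)
    then show ?thesis by (auto simp: incidence_def)
  qed
  moreover have "\<exists>j. incidence S j \<noteq> 0" if "S \<in> choice_sets D" for S
    using choice_set_nonempty[OF assms(1) that] by (auto simp: incidence_def)
  ultimately show ?thesis
    by (simp add: no_zero_lines_def)
qed

lemma luce_denominator_pos: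
  fixes D :: "'a::finite choice_data"
  assumes "luce_data D" "0 < n_wins D j" "positive s"
  shows "0 < (\<Sum>S\<in>{S \<in> choice_sets D. j \<in> S}. real (n_obs D S) / (\<Sum>k\<in>S. s k))"
proof -
  obtain S where "S \<in> choice_sets D" "j \<in> S"
    using assms(1,2) by (rule obtain_win)
  then show ?thesis
    using assms by (intro sum_pos) (auto simp: n_obs_pos choice_set_sum_pos)
qed

lemma positive_luce_sinkhorn:
  fixes D :: "'a::finite choice_data"
  assumes "luce_data D" "\<And>j. 0 < n_wins D j" "positive s"
  shows "positive (luce_sinkhorn D s)"
  using assms by (simp add: positive_def luce_sinkhorn_sets luce_denominator_pos)

section \<open>Comparing iterations\<close>

lemma positive_funpow:
  fixes T :: "('a \<Rightarrow> real) \<Rightarrow> 'a \<Rightarrow> real"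
  assumes "\<And>s. positive s \<Longrightarrow> positive (T s)" "positive s"
  shows "positive ((T ^^ t) s)"
  using assms(2) by (induction t) (simp_all add: assms(1))

text \<open>Agreement of \<open>T\<close> and \<open>U\<close> is known at positive vectors only;
  since \<open>T\<close> preserves positivity, its iterates never leave that region.\<close>

lemma same_iterationI:
  assumes "\<And>s. positive s \<Longrightarrow> positive (T s)" "\<And>s. positive s \<Longrightarrow> T s = U s"
  shows "same_iteration T U"
proof -
  have "(T ^^ t) s = (U ^^ t) s" if "positive s" for s t
  proof (induction t)
    case (Suc t)
    have "T ((T ^^ t) s) = U ((T ^^ t) s)"
      using assms that by (intro assms(2) positive_funpow)
    with Suc show ?case by simp
  qed simp
  with assms(2) show ?thesis by (auto simp: same_iteration_def)
qed

lemma positive_cyclic: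
  assumes "\<And>s. positive s \<Longrightarrow> positive (T s)" "positive s"
  shows "positive (cyclic T js s)"
  using assms(2)
proof (induction js arbitrary: s)
  case (Cons j js)
  have "positive (s(j := T s j))"
    using assms(1)[OF Cons.prems] Cons.prems by (simp add: positive_def)
  from Cons.IH[OF this] show ?case by (simp add: cyclic_def del: fun_upd_apply)
qed (simp add: cyclic_def)

text \<open>Within a sweep, each new component is taken from the positive vector \<open>T s\<close>,
  so every intermediate vector stays positive.\<close>

lemma cyclic_cong:
  assumes "\<And>s. positive s \<Longrightarrow> positive (T s)" "\<And>s. positive s \<Longrightarrow> T s = U s" "positive s"
  shows "cyclic T js s = cyclic U js s"
  using assms(3)
proof (induction js arbitrary: s)
  case (Cons j js)
  have "positive (s(j := T s j))"
    using assms(1)[OF Cons.prems] Cons.prems by (simp add: positive_def)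
  from Cons.IH[OF this] show ?case
    by (simp add: cyclic_def assms(2) Cons.prems del: fun_upd_apply)
qed (simp add: cyclic_def)

lemma same_iteration_cyclic:
  assumes "\<And>s. positive s \<Longrightarrow> positive (T s)" "\<And>s. positive s \<Longrightarrow> T s = U s"
  shows "same_iteration (cyclic T js) (cyclic U js)"
  using assms by (intro same_iterationI positive_cyclic cyclic_cong) auto

section \<open>The named algorithms\<close>

lemma luce_data_btl_choices: "luce_data (btl_choices C)"
  by (auto simp: luce_data_def btl_choices_def)

lemma n_wins_btl_choices: "n_wins (btl_choices C) j = btl_wins C j"
  by (simp add: n_wins_eq_count btl_choices_def btl_wins_def size_filter_eq_count
      image_mset.compositionality comp_def case_prod_unfold)

text \<open>By induction on the comparisons: one that involves \<open>j\<close> raises exactly one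
  summand, that of the opponent, and one without \<open>j\<close> raises none. As winner and loser
  differ, the opponent lies in \<open>UNIV - {j}\<close>.\<close>

lemma btl_denominator:
  assumes "btl_data C"
  shows "(\<Sum>x\<in>#btl_choices C. incidence (fst x) j / (\<Sum>k\<in>fst x. s k)) =
    (\<Sum>k\<in>UNIV - {j}. real (btl_comparisons C j k) / (s j + s (k :: 'a::finite)))"
  using assms
proof (induction C)
  case empty
  then show ?case by (simp add: btl_choices_def btl_comparisons_def)
next
  case (add c C)
  obtain a b where c: "c = (a, b)" by (cases c)
  with add.prems have ab: "a \<noteq> b" and C: "btl_data C"
    by (auto simp: btl_data_def)
  let ?e = "\<lambda>k. if {a, b} = {j, k} then 1 / (s j + s k) else 0"
  have "real (btl_comparisons (add_mset c C) j k) / (s j + s k) =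
      ?e k + real (btl_comparisons C j k) / (s j + s k)" for k
    by (auto simp: btl_comparisons_def c doubleton_eq_iff add_divide_distrib)
  moreover have "(\<Sum>k\<in>UNIV - {j}. ?e k) = incidence {a, b} j / (s a + s b)"
  proof -
    consider "j = a" | "j = b" | "j \<noteq> a" "j \<noteq> b" by blast
    then show ?thesis
    proof cases
      case 1
      then have "?e k = (if k = b then 1 / (s a + s b) else 0)" for k
        by (auto simp: doubleton_eq_iff)
      with 1 ab show ?thesis by (simp add: incidence_def)
    next
      case 2
      then have "?e k = (if k = a then 1 / (s a + s b) else 0)" for k
        by (auto simp: doubleton_eq_iff add.commute)
      with 2 ab show ?thesis by (simp add: incidence_def)
    next
      case 3
      then show ?thesis by (auto simp: incidence_def doubleton_eq_iff intro!: sum.neutral)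
    qed
  qed
  ultimately show ?case
    using add.IH[OF C] ab by (simp add: sum.distrib btl_choices_def c)
qed

lemma luce_sinkhorn_btl_choices:
  assumes "btl_data C"
  shows "luce_sinkhorn (btl_choices C) s = zermelo_step C s"
  by (rule ext) (simp add: luce_sinkhorn_obs n_wins_btl_choices zermelo_step_def btl_denominator[OF assms])

section \<open>Rankings: Hunter's algorithm\<close>

lemma sum_mset_sum: "sum_mset (\<Sum>i\<in>A. f i) = (\<Sum>i\<in>A. sum_mset (f i :: 'b::comm_monoid_add multiset))"
  by (induction A rule: infinite_finite_induct) auto

lemma image_mset_sum: "image_mset g (\<Sum>i\<in>A. f i) = (\<Sum>i\<in>A. image_mset g (f i))"
  by (induction A rule: infinite_finite_induct) auto

lemma luce_data_pl_choices: "luce_data (pl_choices N l a)"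
  by (auto simp: luce_data_def pl_choices_def set_mset_sum)

text \<open>Items in a ranking are distinct, so an item wins at most one of the choices into which
  the ranking is broken, and none exactly if it is absent or last.\<close>

lemma n_wins_pl_choices:
  assumes "rankings N l a"
  shows "n_wins (pl_choices N l a) k = pl_wins N l a k"
proof -
  have "(\<Sum>j=1..l i - 1. if a i j = k then 1 else 0) =
      (if k \<in> a i ` {1..l i} \<and> k \<noteq> a i (l i) then 1 else 0 :: nat)" if "i \<in> {1..N}" for i
  proof -
    from assms that have inj: "inj_on (a i) {1..l i}" and l: "1 \<le> l i"
      by (auto simp: rankings_def)
    show ?thesis
    proof (cases "k \<in> a i ` {1..l i} \<and> k \<noteq> a i (l i)")
      case True
      then obtain r where r: "r \<in> {1..l i}" "a i r = k" by blast
      with True have "r \<noteq> l i" by blast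
      \<comment> \<open>By injectivity \<open>k\<close> sits at position \<open>r\<close> only, and
        \<open>r \<noteq> l i\<close> puts \<open>r\<close> into the summation range, which stops at
        \<open>l i - 1\<close>.\<close>
      have "(\<Sum>j=1..l i - 1. if a i j = k then 1 else 0) = (\<Sum>j=1..l i - 1. if j = r then 1 else 0 :: nat)"
        using inj r by (intro sum.cong) (auto dest: inj_onD)
      with True r \<open>r \<noteq> l i\<close> show ?thesis by auto
    next
      case False
      \<comment> \<open>Otherwise \<open>k\<close> would be ranked and, by injectivity and
        \<open>j < l i\<close>, not last.\<close>
      moreover have "a i j \<noteq> k" if "j \<in> {1..l i - 1}" for j
        using False inj that l by (auto dest!: inj_onD[of _ _ j "l i"])
      ultimately show ?thesis by (auto intro!: sum.neutral)
    qed
  qed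
  then have "n_wins (pl_choices N l a) k =
      (\<Sum>i=1..N. if k \<in> a i ` {1..l i} \<and> k \<noteq> a i (l i) then 1 else 0)"
    by (simp add: n_wins_eq_count pl_choices_def image_mset_sum count_sum cong: if_cong)
  then show ?thesis
    by (simp add: pl_wins_def sum.If_cases Int_def)
qed

lemma luce_sinkhorn_pl_choices:
  assumes "rankings N l a"
  shows "luce_sinkhorn (pl_choices N l a) s = hunter_step N l (a :: nat \<Rightarrow> nat \<Rightarrow> 'a::finite) s"
proof
  fix k
  have "incidence (a i ` {j..l i}) k / (\<Sum>k\<in>a i ` {j..l i}. s k) =
      pl_delta l a i j k * inverse (\<Sum>j'=j..l i. s (a i j'))"
    if "i \<in> {1..N}" "j \<in> {1..l i - 1}" for i j
  proof -
    \<comment> \<open>Injectivity turns the total score of the remaining items into a sum over their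
      positions.\<close>
    have "inj_on (a i) {j..l i}"
      by (rule inj_on_subset[of _ "{1..l i}"]) (use assms that in \<open>auto simp: rankings_def\<close>)
    moreover have "incidence (a i ` {j..l i}) k = pl_delta l a i j k"
      using that by (force simp: incidence_def pl_delta_def)
    ultimately show ?thesis by (simp add: sum.reindex divide_inverse)
  qed
  then have "(\<Sum>x\<in>#pl_choices N l a. incidence (fst x) k / (\<Sum>k\<in>fst x. s k)) =
      (\<Sum>i=1..N. \<Sum>j=1..l i - 1. pl_delta l a i j k * inverse (\<Sum>j'=j..l i. s (a i j')))"
    by (simp add: pl_choices_def image_mset_sum sum_mset_sum)
  then show "luce_sinkhorn (pl_choices N l a) s k = hunter_step N l a s k"
    by (simp add: luce_sinkhorn_obs hunter_step_def n_wins_pl_choices[OF assms])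
qed

section \<open>Network choice: ChoiceRank\<close>

lemma count_image_mset_swap: "count (image_mset prod.swap T) (k, j) = count T (j, k)"
  by (induction T) auto

lemma luce_data_network_choices: "set_mset T \<subseteq> E \<Longrightarrow> luce_data (network_choices E T)"
  by (auto simp: luce_data_def network_choices_def n_out_def)

lemma c_in_eq_count:
  fixes E :: "('a::finite \<times> 'a) set"
  assumes "set_mset T \<subseteq> E"
  shows "c_in E T j = count (image_mset snd T) j"
proof -
  have "c_in E T j = (\<Sum>k\<in>UNIV. count T (k, j))"
    unfolding c_in_def using assms by (intro sum.mono_neutral_left) (auto simp: n_in_def count_eq_zero_iff)
  then show ?thesis by (simp add: sum_count_Pair_left)
qed

text \<open>Observed transitions follow edges, so the sum extends from \<open>n_out E j\<close> to
  all nodes. Reversing the transitions then turns counts by source into counts by target, to which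
  \<open>sum_count_Pair_left\<close> applies.\<close>

lemma c_out_eq_count:
  fixes E :: "('a::finite \<times> 'a) set"
  assumes "set_mset T \<subseteq> E"
  shows "c_out E T j = count (image_mset fst T) j"
proof -
  have "c_out E T j = (\<Sum>k\<in>UNIV. count T (j, k))"
    unfolding c_out_def using assms by (intro sum.mono_neutral_left) (auto simp: n_out_def count_eq_zero_iff)
  also have "\<dots> = (\<Sum>k\<in>UNIV. count (image_mset prod.swap T) (k, j))"
    by (simp add: count_image_mset_swap)
  also have "\<dots> = count (image_mset snd (image_mset prod.swap T)) j"
    by (rule sum_count_Pair_left) auto
  finally show ?thesis by (simp add: image_mset.compositionality comp_def)
qed

lemma n_wins_network_choices:
  fixes E :: "('a::finite \<times> 'a) set"
  assumes "set_mset T \<subseteq> E"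
  shows "n_wins (network_choices E T) j = c_in E T j"
  by (simp add: c_in_eq_count[OF assms] n_wins_eq_count network_choices_def
      image_mset.compositionality comp_def case_prod_unfold)

text \<open>Transitions are regrouped by source node instead of by choice set. Several nodes may
  share a choice set, but the sum over observations is the same under either grouping.\<close>

lemma luce_sinkhorn_network_choices:
  fixes E :: "('a::finite \<times> 'a) set"
  assumes "set_mset T \<subseteq> E"
  shows "luce_sinkhorn (network_choices E T) s = choicerank_step E T s"
proof
  fix j
  have "(\<Sum>k\<in>n_in E j. choicerank_gamma E T s k) =
      (\<Sum>k\<in>UNIV. if k \<in> n_in E j then choicerank_gamma E T s k else 0)"
    by (simp add: sum.If_cases)
  \<comment> \<open>Node \<open>k\<close> is an in-neighbour of \<open>j\<close> iff
    \<open>j\<close> belongs to the choice set \<open>n_out E k\<close>, so the incidence factor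
    realizes the restriction to \<open>n_in E j\<close>.\<close>
  also have "\<dots> = (\<Sum>k\<in>UNIV. real (count (image_mset fst T) k) *
      (incidence (n_out E k) j / (\<Sum>l\<in>n_out E k. s l)))"
    by (rule sum.cong) (auto simp: choicerank_gamma_def c_out_eq_count[OF assms] incidence_def n_in_def n_out_def)
  also have "\<dots> = (\<Sum>k\<in>#image_mset fst T. incidence (n_out E k) j / (\<Sum>l\<in>n_out E k. s l))"
    by (rule sum_count_mult) auto
  also have "\<dots> = (\<Sum>x\<in>#network_choices E T. incidence (fst x) j / (\<Sum>l\<in>fst x. s l))"
    by (simp add: network_choices_def image_mset.compositionality comp_def case_prod_unfold)
  finally show "luce_sinkhorn (network_choices E T) s j = choicerank_step E T s j"
    by (simp add: luce_sinkhorn_obs choicerank_step_def n_wins_network_choices[OF assms])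
qed

section \<open>Logit demand with intercepts: BLP\<close>

lemma luce_data_logit_choices: "luce_data (logit_choices M)"
  by (auto simp: luce_data_def logit_choices_def)

lemma n_wins_logit_choices: "n_wins (logit_choices M) j = count M j"
  by (simp add: n_wins_eq_count logit_choices_def image_mset.compositionality comp_def)

text \<open>All observations share the choice set \<open>UNIV\<close>, so the denominator is their
  number over the total score. Division by zero yielding 0 covers empty data and a zero
  total.\<close>

lemma luce_sinkhorn_logit_choices:
  "luce_sinkhorn (logit_choices M) s j = observed_share M j * (\<Sum>k\<in>UNIV. s k)"
proof -
  have "(\<Sum>x\<in>#logit_choices M. incidence (fst x) j / (\<Sum>k\<in>fst x. s k)) =
      real (size M) / (\<Sum>k\<in>UNIV. s k)"
    by (simp add: logit_choices_def image_mset.compositionality comp_def incidence_def)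
  then show ?thesis
    by (simp add: luce_sinkhorn_obs n_wins_logit_choices observed_share_def)
qed

text \<open>With \<open>\<theta> = ln s\<close>, the logarithm of the expected share is
  \<open>ln (s j)\<close> minus that of the total score. In the BLP update \<open>ln (s j)\<close>
  cancels, and the logarithm of the Sinkhorn update remains.\<close>

lemma ln_luce_sinkhorn_logit_choices:
  assumes "\<And>j. 0 < observed_share M j" "positive s"
  shows "(\<lambda>j. ln (luce_sinkhorn (logit_choices M) s j)) = blp_step M (\<lambda>j. ln (s (j :: 'a::finite)))"
proof
  fix j
  have s: "0 < s k" for k
    using assms(2) by (simp add: positive_def)
  then have "0 < (\<Sum>k\<in>UNIV. s k)" "s j \<noteq> 0"
    by (auto intro!: sum_pos simp: less_imp_neq[symmetric])
  then show "ln (luce_sinkhorn (logit_choices M) s j) = blp_step M (\<lambda>j. ln (s j)) j"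
    using assms(1)[of j] s
    by (simp add: luce_sinkhorn_logit_choices blp_step_def expected_share_def ln_mult ln_div)
qed

section \<open>Sinkhorn's algorithm as an MM algorithm\<close>

text \<open>The inequality \<open>ln z \<le> z - 1\<close> has equality only at
  \<open>z = 1\<close>, here with \<open>z = x / (q / c)\<close>. Strictness makes the maximizer of
  the surrogate unique.\<close>

lemma ln_less_tangent:
  assumes "0 < q" "0 < c" "0 < x" "x \<noteq> q / (c :: real)"
  shows "q * ln x - c * x < q * ln (q / c) - c * (q / c)"
proof -
  have "ln (x / (q / c)) < x / (q / c) - 1"
    using assms ln_le_minus_one[of "x / (q / c)"] ln_eq_minus_one[of "x / (q / c)"]
    by (force simp: field_simps)
  then have "q * (ln x - ln (q / c)) < q * (x / (q / c) - 1)"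
    using assms by (simp add: ln_divide_pos del: divide_divide_eq_right)
  also have "\<dots> = c * x - q"
    using assms by (simp add: field_simps)
  finally show ?thesis
    using assms by (simp add: algebra_simps)
qed

lemma MM_algorithm_sinkhorn:
  fixes A :: "'r \<Rightarrow> 'a::finite \<Rightarrow> real"
  assumes "balancing_problem I A p q" "no_zero_lines I A"
  shows "MM_algorithm {s. positive s} (sinkhorn_potential I A p q)
    (sinkhorn_minorizer I A p q) (sinkhorn_step I A p q)"
proof -
  have I: "finite I" and A: "\<And>i j. i \<in> I \<Longrightarrow> 0 \<le> A i j" and p: "\<And>i. i \<in> I \<Longrightarrow> 0 < p i"
    and q: "\<And>j. 0 < q j"
    using assms(1) by (auto simp: balancing_problem_def)
  have row_pos: "0 < (\<Sum>j\<in>UNIV. A i j * s j)" if "i \<in> I" "positive s" for i s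
  proof -
    obtain j where j: "A i j \<noteq> 0"
      using assms(2) \<open>i \<in> I\<close> by (auto simp: no_zero_lines_def)
    have "0 < s k" for k
      using \<open>positive s\<close> by (simp add: positive_def)
    moreover have "0 < A i j"
      using j A[OF \<open>i \<in> I\<close>, of j] by simp
    ultimately show ?thesis
      using A[OF \<open>i \<in> I\<close>] by (intro sum_pos2[of _ j]) (auto simp: less_imp_le)
  qed
  have d1_pos: "0 < sinkhorn_d1 A p s i" if "i \<in> I" "positive s" for i s
    using row_pos[OF that] p[OF that(1)] by (simp add: sinkhorn_d1_def)
  have lower: "sinkhorn_minorizer I A p q y x \<le> sinkhorn_potential I A p q x"
    if "positive x" "positive y" for x y
  proof -
    have "p i * ln (\<Sum>j\<in>UNIV. A i j * x j) \<le> sinkhorn_d1 A p y i * (\<Sum>j\<in>UNIV. A i j * x j)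
        + p i * (ln (\<Sum>j\<in>UNIV. A i j * y j) - 1)" if "i \<in> I" for i
    proof -
      let ?u = "\<Sum>j\<in>UNIV. A i j * x j" and ?v = "\<Sum>j\<in>UNIV. A i j * y j"
      have u: "0 < ?u" and v: "0 < ?v"
        using row_pos \<open>i \<in> I\<close> \<open>positive x\<close> \<open>positive y\<close> by auto
      have "ln ?u \<le> ln ?v + ?u / ?v - 1"
        using ln_le_minus_one[of "?u / ?v"] u v by (simp add: ln_div)
      then have "p i * ln ?u \<le> p i * (ln ?v + ?u / ?v - 1)"
        using p[OF that] by simp
      then show ?thesis
        by (simp add: sinkhorn_d1_def algebra_simps)
    qed
    then show ?thesis
      by (simp add: sinkhorn_minorizer_def sinkhorn_potential_def sum_mono)
  qed
  have touch: "sinkhorn_minorizer I A p q y y = sinkhorn_potential I A p q y" if "positive y" for y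
  proof -
    \<comment> \<open>At \<open>y\<close> itself the row scaling makes row \<open>i\<close> sum to
      \<open>p i\<close>, which cancels the \<open>- 1\<close> term of the surrogate.\<close>
    have "sinkhorn_d1 A p y i * (\<Sum>j\<in>UNIV. A i j * y j) = p i" if "i \<in> I" for i
      using row_pos[OF that \<open>positive y\<close>] by (simp add: sinkhorn_d1_def)
    then show ?thesis
      by (simp add: sinkhorn_minorizer_def sinkhorn_potential_def right_diff_distrib)
  qed
  \<comment> \<open>\<open>c y j\<close> is the slope of the linear term in coordinate
    \<open>j\<close> and also the denominator of the column update; hence the maximizer is the
    Sinkhorn step.\<close>
  define c where "c y j = (\<Sum>i\<in>I. A i j * sinkhorn_d1 A p y i)" for y j
  have c_pos: "0 < c y j" if "positive y" for y j
  proof -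
    obtain i where i: "i \<in> I" "A i j \<noteq> 0"
      using assms(2) by (auto simp: no_zero_lines_def)
    then have "0 < A i j"
      using A[OF i(1), of j] by simp
    then show ?thesis
      unfolding c_def using A I d1_pos[OF _ that] i(1)
      by (intro sum_pos2[of _ i]) (auto simp: less_imp_le)
  qed
  have step: "sinkhorn_step I A p q y j = q j / c y j" for y j
    by (simp add: sinkhorn_step_def sinkhorn_d0_def c_def)
  \<comment> \<open>Exchanging the sums over rows and columns decouples the coordinates; the
    subtracted sum depends on \<open>y\<close> alone.\<close>
  have separate: "sinkhorn_minorizer I A p q y x = (\<Sum>j\<in>UNIV. q j * ln (x j) - c y j * x j)
      - (\<Sum>i\<in>I. p i * (ln (\<Sum>j\<in>UNIV. A i j * y j) - 1))" for x y
  proof -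
    have "(\<Sum>i\<in>I. sinkhorn_d1 A p y i * (\<Sum>j\<in>UNIV. A i j * x j)) =
        (\<Sum>i\<in>I. \<Sum>j\<in>UNIV. A i j * sinkhorn_d1 A p y i * x j)"
      by (simp add: sum_distrib_left mult_ac)
    also have "\<dots> = (\<Sum>j\<in>UNIV. c y j * x j)"
      by (subst sum.swap) (simp add: c_def sum_distrib_right)
    finally show ?thesis
      by (simp add: sinkhorn_minorizer_def sum.distrib sum_subtractf)
  qed
  have max: "sinkhorn_minorizer I A p q y x < sinkhorn_minorizer I A p q y (sinkhorn_step I A p q y)"
    if "positive y" "positive x" "x \<noteq> sinkhorn_step I A p q y" for x y
  proof -
    have x: "0 < x j" for j
      using \<open>positive x\<close> by (simp add: positive_def)
    have less: "q j * ln (x j) - c y j * x j < q j * ln (q j / c y j) - c y j * (q j / c y j)"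
      if "x j \<noteq> q j / c y j" for j
      using ln_less_tangent q c_pos[OF \<open>positive y\<close>] x that by blast
    obtain j where "x j \<noteq> q j / c y j"
      using \<open>x \<noteq> _\<close> step by (metis ext)
    moreover have "q k * ln (x k) - c y k * x k \<le> q k * ln (q k / c y k) - c y k * (q k / c y k)" for k
      by (cases "x k = q k / c y k") (simp, rule less_imp_le[OF less])
    ultimately have "(\<Sum>j\<in>UNIV. q j * ln (x j) - c y j * x j) <
        (\<Sum>j\<in>UNIV. q j * ln (q j / c y j) - c y j * (q j / c y j))"
      using less by (intro sum_strict_mono_ex1) (simp, blast, blast)
    then show ?thesis
      unfolding separate step by simp
  qed
  have "positive (sinkhorn_step I A p q y)" if "positive y" for y
    using q c_pos[OF that] by (simp add: positive_def step)
  with lower touch max show ?thesis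
    by (auto simp: MM_algorithm_def)
qed

lemma MM_algorithm_cong:
  assumes "MM_algorithm X f Q T" "\<And>x. x \<in> X \<Longrightarrow> f x = g x"
  shows "MM_algorithm X g Q T"
  using assms by (auto simp: MM_algorithm_def)

text \<open>Positivity splits the logarithm of each choice probability. The logarithms of the chosen
  scores group by item into \<open>n_wins\<close>, those of the choice set totals by set into
  \<open>n_obs\<close>.\<close>

lemma sinkhorn_potential_eq_luce_loglik:
  fixes D :: "'a::finite choice_data"
  assumes "luce_data D" "positive s"
  shows "sinkhorn_potential (choice_sets D) incidence
    (\<lambda>S. real (n_obs D S)) (\<lambda>j. real (n_wins D j)) s = luce_loglik D s"
proof -
  have "luce_loglik D s = (\<Sum>x\<in>#D. ln (s (snd x)) - ln (\<Sum>k\<in>fst x. s k))"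
    unfolding luce_loglik_def
  proof (intro arg_cong[of _ _ sum_mset] image_mset_cong)
    fix x assume "x \<in># D"
    then have "0 < (\<Sum>k\<in>fst x. s k)"
      using assms by (intro choice_set_sum_pos) (auto simp: choice_sets_def)
    then show "(case x of (S, j) \<Rightarrow> ln (s j / (\<Sum>k\<in>S. s k))) = ln (s (snd x)) - ln (\<Sum>k\<in>fst x. s k)"
      using assms(2) by (auto simp: positive_def ln_divide_pos split: prod.split)
  qed
  also have "\<dots> = (\<Sum>x\<in>#D. ln (s (snd x))) - (\<Sum>x\<in>#D. ln (\<Sum>k\<in>fst x. s k))"
    by (induction D) auto
  also have "(\<Sum>x\<in>#D. ln (s (snd x))) = (\<Sum>j\<in>UNIV. real (n_wins D j) * ln (s j))"
    using sum_count_mult[of UNIV "image_mset snd D" "\<lambda>j. ln (s j)"]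
    by (simp add: n_wins_eq_count image_mset.compositionality comp_def)
  finally show ?thesis
    by (simp add: sinkhorn_potential_def sum_incidence sum_n_obs_mult)
qed

lemma MM_algorithm_luce_sinkhorn:
  fixes D :: "'a::finite choice_data"
  assumes "luce_data D" "\<And>j. 0 < n_wins D j"
  shows "MM_algorithm {s. positive s} (luce_loglik D)
    (sinkhorn_minorizer (choice_sets D) incidence (\<lambda>S. real (n_obs D S)) (\<lambda>j. real (n_wins D j)))
    (luce_sinkhorn D)"
  unfolding luce_sinkhorn_def
proof (rule MM_algorithm_cong[OF MM_algorithm_sinkhorn])
  show "balancing_problem (choice_sets D) incidence
      (\<lambda>S. real (n_obs D S)) (\<lambda>j. real (n_wins D j))"
    using luce_balancing_problemI[OF assms(2)] by (simp add: luce_balancing_problem_def)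
  show "no_zero_lines (choice_sets D) incidence"
    using assms by (rule luce_no_zero_lines)
qed (simp add: sinkhorn_potential_eq_luce_loglik assms(1))

section \<open>Message passing and moment conditions\<close>

text \<open>Each node reads only what its neighbours sent, so the restrictions vanish. The reply is
  the row scaling \<open>sinkhorn_d1\<close>, the same for every receiving item, and the item nodes
  perform the column scaling.\<close>

lemma luce_sinkhorn_message_passing:
  "luce_sinkhorn D = message_passing_step (choice_sets D) (\<lambda>S x. \<Sum>k\<in>S. x k)
     (\<lambda>S j \<sigma>. real (n_obs D S) / \<sigma>)
     (\<lambda>j m. real (n_wins D j) / (\<Sum>S\<in>{S \<in> choice_sets D. j \<in> S}. m S))"
  by (intro ext) (simp add: luce_sinkhorn_sets message_passing_step_def)

text \<open>The aggregation is that of Sinkhorn's algorithm. The reply differs: it is proportional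
  to the aggregate and depends on the receiving item through \<open>n_chosen\<close>.\<close>

lemma asr_step_message_passing:
  "asr_step D = message_passing_step (choice_sets D) (\<lambda>S x. \<Sum>k\<in>S. x k)
     (\<lambda>S j \<sigma>. real (n_chosen D j S) * \<sigma>)
     (\<lambda>j m. 1 / (\<Sum>S\<in>{S \<in> choice_sets D. j \<in> S}. real (n_obs D S)) *
            (\<Sum>S\<in>{S \<in> choice_sets D. j \<in> S}. m S))"
  by (intro ext) (simp add: asr_step_def message_passing_step_def)

lemma same_iteration_refl: "same_iteration T T"
  by (simp add: same_iteration_def)

text \<open>Being based on a moment condition is rendered as having its positive solutions as
  positive fixed points. At each \<open>j\<close> the two equations differ by the positive
  denominator of the update.\<close>

lemma luce_sinkhorn_fixed_iff:
  fixes D :: "'a::finite choice_data"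
  assumes "luce_data D" "\<And>j. 0 < n_wins D j" "positive s"
  shows "luce_sinkhorn D s = s \<longleftrightarrow> ml_moment D s"
proof -
  have "luce_sinkhorn D s j = s j \<longleftrightarrow> real (n_wins D j) =
      (\<Sum>S\<in>{S \<in> choice_sets D. j \<in> S}. real (n_obs D S) * (s j / (\<Sum>k\<in>S. s k)))" for j
  proof -
    have "(\<Sum>S\<in>{S \<in> choice_sets D. j \<in> S}. real (n_obs D S) * (s j / (\<Sum>k\<in>S. s k))) =
        s j * (\<Sum>S\<in>{S \<in> choice_sets D. j \<in> S}. real (n_obs D S) / (\<Sum>k\<in>S. s k))"
      by (simp add: sum_distrib_left mult_ac)
    with luce_denominator_pos[OF assms(1) assms(2)[of j] assms(3)] show ?thesis
      by (simp add: luce_sinkhorn_sets divide_eq_eq)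
  qed
  then show ?thesis
    by (auto simp: ml_moment_def fun_eq_iff)
qed

text \<open>At each \<open>j\<close>, clearing the divisions by \<open>s j\<close> and by the number
  of observations offering \<open>j\<close> turns one equation into the other. That number is
  positive because \<open>j\<close> wins somewhere.\<close>

lemma asr_step_fixed_iff:
  fixes D :: "'a::finite choice_data"
  assumes "luce_data D" "\<And>j. 0 < n_wins D j" "positive s"
  shows "asr_step D s = s \<longleftrightarrow> asr_moment D s"
proof -
  have "asr_step D s j = s j \<longleftrightarrow> (\<Sum>S\<in>{S \<in> choice_sets D. j \<in> S}. real (n_obs D S)) =
      (\<Sum>S\<in>{S \<in> choice_sets D. j \<in> S}. real (n_chosen D j S) / (s j / (\<Sum>k\<in>S. s k)))" for j
  proof -
    obtain S where "S \<in> choice_sets D" "j \<in> S"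
      using assms(1) assms(2)[of j] by (rule obtain_win)
    then have R: "0 < (\<Sum>S\<in>{S \<in> choice_sets D. j \<in> S}. real (n_obs D S))"
      by (intro sum_pos) (auto simp: n_obs_pos)
    have B: "(\<Sum>S\<in>{S \<in> choice_sets D. j \<in> S}. real (n_chosen D j S) / (s j / (\<Sum>k\<in>S. s k))) =
        (\<Sum>S\<in>{S \<in> choice_sets D. j \<in> S}. real (n_chosen D j S) * (\<Sum>k\<in>S. s k)) / s j"
      by (simp add: sum_divide_distrib)
    have *: "1 / r * b = s j \<longleftrightarrow> r = b / s j" if "0 < r" for r b
    proof -
      have "s j \<noteq> 0"
        using assms(3) by (auto simp: positive_def dest: spec[of _ j])
      with that show ?thesis
        by (simp add: divide_eq_eq eq_divide_eq) (auto simp: mult.commute)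
    qed
    show ?thesis
      unfolding asr_step_def B by (rule *[OF R])
  qed
  then show ?thesis
    by (auto simp: asr_moment_def fun_eq_iff)
qed

text \<open>
  At uniform scores, the one win that item 1 has above expectation in the triple cancels the one it
  lacks in the pair. The ASR condition weights wins by the size of the choice set, which destroys the
  cancellation.
\<close>

lemma moment_conditions_differ:
  "\<exists>(D :: 3 choice_data) s.
     luce_data D \<and> (\<forall>j. 0 < n_wins D j) \<and> positive s \<and> ml_moment D s \<and> \<not> asr_moment D s"
proof -
  \<comment> \<open>Under uniform scores each item expects one win from the three triples, and items
    1 and 3 each expect one from the two pairs. Item 1 has 2 + 0 wins and item 3 has 0 + 2, matching
    1 + 1; item 2 has the expected 1.\<close>
  define D :: "3 choice_data" where
    "D = {#(UNIV, 1), (UNIV, 1), (UNIV, 2), ({1, 3}, 3), ({1, 3}, 3)#}"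
  define s :: "3 \<Rightarrow> real" where "s = (\<lambda>_. 1)"
  \<comment> \<open>In the type \<open>3\<close> the numeral 3 denotes 0, so these numerals name all
    three elements.\<close>
  have distinct: "(1::3) \<noteq> 2" "(1::3) \<noteq> 3" "(2::3) \<noteq> 3"
    by simp_all
  have pair: "{1, 3} \<noteq> (UNIV :: 3 set)"
    using distinct UNIV_I[of "2::3"] by (metis insertE singletonD)
  have sets: "choice_sets D = {UNIV, {1, 3}}"
    by (auto simp: D_def choice_sets_def)
  have obs: "n_obs D UNIV = 3" "n_obs D {1, 3} = 2"
    using pair by (auto simp: D_def n_obs_def)
  have wins: "n_wins D 1 = 2" "n_wins D 2 = 1" "n_wins D 3 = 2"
    using distinct by (simp_all add: D_def n_wins_eq_count)
  have chosen: "n_chosen D 1 UNIV = 2" "n_chosen D 1 {1, 3} = 0"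
    using pair distinct by (simp_all add: D_def n_chosen_def)
  have adj: "{S \<in> choice_sets D. 1 \<in> S} = {UNIV, {1, 3}}"
    "{S \<in> choice_sets D. 2 \<in> S} = {UNIV}" "{S \<in> choice_sets D. 3 \<in> S} = {UNIV, {1, 3}}"
    using distinct unfolding sets by auto
  have "luce_data D"
    by (simp add: D_def luce_data_def)
  moreover have "\<forall>j. 0 < n_wins D j"
    by (simp add: forall_3 wins)
  moreover have "positive s"
    by (simp add: positive_def s_def)
  moreover have "ml_moment D s"
    unfolding ml_moment_def forall_3 adj using pair[symmetric] by (simp add: wins obs s_def)
  \<comment> \<open>For item 1 the left side is 3 + 2 = 5, the right side 2 * 3 + 0 * 2 = 6.\<close>
  moreover have "\<not> asr_moment D s"
    unfolding asr_moment_def forall_3 adj using pair[symmetric] by (simp add: obs chosen s_def)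
  ultimately show ?thesis by blast
qed

theorem theorem2:
  shows
    \<comment> \<open>Zermelo, Dykstra, and (cyclic) Ford\<close>
    "(\<forall>C :: ('a::finite \<times> 'a) multiset.
        btl_data C \<and> (\<forall>j. 0 < btl_wins C j) \<longrightarrow>
          luce_data (btl_choices C) \<and> luce_balancing_problem (btl_choices C) \<and>
          same_iteration (luce_sinkhorn (btl_choices C)) (zermelo_step C) \<and>
          (\<forall>js. distinct js \<and> set js = UNIV \<longrightarrow>
            same_iteration (cyclic (luce_sinkhorn (btl_choices C)) js)
                           (cyclic (zermelo_step C) js)))
     \<and> \<comment> \<open>Hunter\<close>
     (\<forall>N l (a :: nat \<Rightarrow> nat \<Rightarrow> 'a).
        rankings N l a \<and> (\<forall>k. 0 < pl_wins N l a k) \<longrightarrow>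
          luce_data (pl_choices N l a) \<and> luce_balancing_problem (pl_choices N l a) \<and>
          same_iteration (luce_sinkhorn (pl_choices N l a)) (hunter_step N l a))
     \<and> \<comment> \<open>ChoiceRank\<close>
     (\<forall>(E :: ('a \<times> 'a) set) T.
        set_mset T \<subseteq> E \<and> (\<forall>j. 0 < c_in E T j) \<longrightarrow>
          luce_data (network_choices E T) \<and> luce_balancing_problem (network_choices E T) \<and>
          same_iteration (luce_sinkhorn (network_choices E T)) (choicerank_step E T))
     \<and> \<comment> \<open>BLP, with \<open>\<theta> = ln s\<close>\<close>
     (\<forall>M :: 'a multiset.
        (\<forall>j. 0 < observed_share M j) \<longrightarrow>
          luce_data (logit_choices M) \<and> luce_balancing_problem (logit_choices M) \<and>
          (\<forall>s. positive s \<longrightarrow>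
            (\<lambda>j. ln (luce_sinkhorn (logit_choices M) s j)) = blp_step M (\<lambda>j. ln (s j))) \<and>
          (\<forall>s t. positive s \<longrightarrow>
            positive ((luce_sinkhorn (logit_choices M) ^^ t) s) \<and>
            (\<lambda>j. ln ((luce_sinkhorn (logit_choices M) ^^ t) s j)) =
              (blp_step M ^^ t) (\<lambda>j. ln (s j))))
     \<and> \<comment> \<open>MM algorithm, for matrix balancing in general and for the Luce log-likelihood\<close>
     (\<forall>(I :: 'r set) (A :: 'r \<Rightarrow> 'a \<Rightarrow> real) p q.
        balancing_problem I A p q \<and> no_zero_lines I A \<longrightarrow>
          MM_algorithm {s. positive s} (sinkhorn_potential I A p q)
            (sinkhorn_minorizer I A p q) (sinkhorn_step I A p q))
     \<and>
     (\<forall>D :: 'a choice_data.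
        luce_data D \<and> (\<forall>j. 0 < n_wins D j) \<longrightarrow>
          luce_balancing_problem D \<and>
          MM_algorithm {s. positive s} (luce_loglik D)
            (sinkhorn_minorizer (choice_sets D) incidence
               (\<lambda>S. real (n_obs D S)) (\<lambda>j. real (n_wins D j)))
            (luce_sinkhorn D))
     \<and> \<comment> \<open>message passing: Sinkhorn and ASR send and aggregate the same estimates\<close>
     (\<forall>D :: 'a choice_data.
        luce_data D \<and> (\<forall>j. 0 < n_wins D j) \<longrightarrow>
          same_iteration (luce_sinkhorn D)
            (message_passing_step (choice_sets D)
               (\<lambda>S x. \<Sum>k\<in>S. x k)
               (\<lambda>S j \<sigma>. real (n_obs D S) / \<sigma>)
               (\<lambda>j m. real (n_wins D j) / (\<Sum>S\<in>{S \<in> choice_sets D. j \<in> S}. m S))) \<and>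
          same_iteration (asr_step D)
            (message_passing_step (choice_sets D)
               (\<lambda>S x. \<Sum>k\<in>S. x k)
               (\<lambda>S j \<sigma>. real (n_chosen D j S) * \<sigma>)
               (\<lambda>j m. 1 / (\<Sum>S\<in>{S \<in> choice_sets D. j \<in> S}. real (n_obs D S)) *
                      (\<Sum>S\<in>{S \<in> choice_sets D. j \<in> S}. m S))) \<and>
          (\<forall>s. positive s \<longrightarrow> (luce_sinkhorn D s = s \<longleftrightarrow> ml_moment D s)) \<and>
          (\<forall>s. positive s \<longrightarrow> (asr_step D s = s \<longleftrightarrow> asr_moment D s)))
     \<and> \<comment> \<open>the two moment conditions are different\<close>
     (\<exists>(D :: 3 choice_data) s.
        luce_data D \<and> (\<forall>j. 0 < n_wins D j) \<and> positive s \<and> ml_moment D s \<and> \<not> asr_moment D s)"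
proof (intro conjI allI impI; (elim conjE)?)
  fix C :: "('a \<times> 'a) multiset" and js :: "'a list"
  assume C: "btl_data C" "\<forall>j. 0 < btl_wins C j"
  then have wins: "0 < n_wins (btl_choices C) j" for j
    by (simp add: n_wins_btl_choices)
  show "luce_data (btl_choices C)" "luce_balancing_problem (btl_choices C)"
    using luce_data_btl_choices luce_balancing_problemI wins by auto
  note T = positive_luce_sinkhorn[OF luce_data_btl_choices wins] luce_sinkhorn_btl_choices[OF C(1)]
  show "same_iteration (luce_sinkhorn (btl_choices C)) (zermelo_step C)"
    using T by (rule same_iterationI)
  show "same_iteration (cyclic (luce_sinkhorn (btl_choices C)) js) (cyclic (zermelo_step C) js)"
    using T by (rule same_iteration_cyclic)
next
  fix N l and a :: "nat \<Rightarrow> nat \<Rightarrow> 'a"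
  assume a: "rankings N l a" "\<forall>k. 0 < pl_wins N l a k"
  then have wins: "0 < n_wins (pl_choices N l a) j" for j
    by (simp add: n_wins_pl_choices)
  show "luce_data (pl_choices N l a)" "luce_balancing_problem (pl_choices N l a)"
    using luce_data_pl_choices luce_balancing_problemI wins by auto
  show "same_iteration (luce_sinkhorn (pl_choices N l a)) (hunter_step N l a)"
    using positive_luce_sinkhorn[OF luce_data_pl_choices wins] luce_sinkhorn_pl_choices[OF a(1)]
    by (rule same_iterationI)
next
  fix E :: "('a \<times> 'a) set" and T
  assume T: "set_mset T \<subseteq> E" "\<forall>j. 0 < c_in E T j"
  then have wins: "0 < n_wins (network_choices E T) j" for j
    by (simp add: n_wins_network_choices)
  show "luce_data (network_choices E T)" "luce_balancing_problem (network_choices E T)"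
    using luce_data_network_choices[OF T(1)] luce_balancing_problemI wins by auto
  show "same_iteration (luce_sinkhorn (network_choices E T)) (choicerank_step E T)"
    using positive_luce_sinkhorn[OF luce_data_network_choices[OF T(1)] wins]
      luce_sinkhorn_network_choices[OF T(1)]
    by (rule same_iterationI)
next
  fix M :: "'a multiset" and s :: "'a \<Rightarrow> real" and t
  assume M: "\<forall>j. 0 < observed_share M j"
  then have share: "0 < observed_share M j" for j
    by simp
  then have wins: "0 < n_wins (logit_choices M) j" for j
    using share[of j] by (auto simp: n_wins_logit_choices observed_share_def zero_less_divide_iff)
  show "luce_data (logit_choices M)" "luce_balancing_problem (logit_choices M)"
    using luce_data_logit_choices luce_balancing_problemI wins by auto
  note pos = positive_luce_sinkhorn[OF luce_data_logit_choices wins]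
  assume s: "positive s"
  show "(\<lambda>j. ln (luce_sinkhorn (logit_choices M) s j)) = blp_step M (\<lambda>j. ln (s j))"
    using share s by (rule ln_luce_sinkhorn_logit_choices)
  show "positive ((luce_sinkhorn (logit_choices M) ^^ t) s)"
    using pos s by (rule positive_funpow)
  show "(\<lambda>j. ln ((luce_sinkhorn (logit_choices M) ^^ t) s j)) = (blp_step M ^^ t) (\<lambda>j. ln (s j))"
  \<comment> \<open>At positive vectors \<open>ln\<close> conjugates one Sinkhorn step to one BLP
    step; positivity of the iterates lets this be repeated.\<close>
  proof (induction t)
    case (Suc t)
    then show ?case
      using ln_luce_sinkhorn_logit_choices[OF share positive_funpow[OF pos s, where t = t]] by simp
  qed simp
next
  fix I :: "'r set" and A :: "'r \<Rightarrow> 'a \<Rightarrow> real" and p q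
  assume "balancing_problem I A p q" "no_zero_lines I A"
  then show "MM_algorithm {s. positive s} (sinkhorn_potential I A p q)
      (sinkhorn_minorizer I A p q) (sinkhorn_step I A p q)"
    by (rule MM_algorithm_sinkhorn)
next
  fix D :: "'a choice_data" and s :: "'a \<Rightarrow> real"
  assume D: "luce_data D" "\<forall>j. 0 < n_wins D j"
  show "luce_balancing_problem D"
    using D(2) by (simp add: luce_balancing_problemI)
  show "MM_algorithm {s. positive s} (luce_loglik D)
      (sinkhorn_minorizer (choice_sets D) incidence
         (\<lambda>S. real (n_obs D S)) (\<lambda>j. real (n_wins D j)))
      (luce_sinkhorn D)"
    using D by (simp add: MM_algorithm_luce_sinkhorn)
  show "same_iteration (luce_sinkhorn D)
      (message_passing_step (choice_sets D) (\<lambda>S x. \<Sum>k\<in>S. x k)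
         (\<lambda>S j \<sigma>. real (n_obs D S) / \<sigma>)
         (\<lambda>j m. real (n_wins D j) / (\<Sum>S\<in>{S \<in> choice_sets D. j \<in> S}. m S)))"
    unfolding luce_sinkhorn_message_passing[symmetric] by (rule same_iteration_refl)
  show "same_iteration (asr_step D)
      (message_passing_step (choice_sets D) (\<lambda>S x. \<Sum>k\<in>S. x k)
         (\<lambda>S j \<sigma>. real (n_chosen D j S) * \<sigma>)
         (\<lambda>j m. 1 / (\<Sum>S\<in>{S \<in> choice_sets D. j \<in> S}. real (n_obs D S)) *
                (\<Sum>S\<in>{S \<in> choice_sets D. j \<in> S}. m S)))"
    unfolding asr_step_message_passing[symmetric] by (rule same_iteration_refl)
  assume "positive s"
  with D show "luce_sinkhorn D s = s \<longleftrightarrow> ml_moment D s" "asr_step D s = s \<longleftrightarrow> asr_moment D s"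
    by (simp_all add: luce_sinkhorn_fixed_iff asr_step_fixed_iff)
next
  show "\<exists>(D :: 3 choice_data) s.
      luce_data D \<and> (\<forall>j. 0 < n_wins D j) \<and> positive s \<and> ml_moment D s \<and> \<not> asr_moment D s"
    by (rule moment_conditions_differ)
qed

end
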